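(* Consider an $M^{X}/G/1$ queue operating under the LCFS-p-repeat-without-resampling discipline, with Poisson batch arrivals of rate $\lambda$, i.i.d. batch sizes with mean $\mu$, i.i.d. service times distributed as $S$ (all independent), and stable, i.e. $E(e^{\lambda S})<(\mu+1)/\mu$. Let $X_0$ be the number of customers in the first batch of a busy period, $S_0$ the service requirement of the first customer to enter service in the busy period, $T_1$ the first interarrival time after the busy period starts, and $M$ the maximum number of customers in the system during a busy period. Let $M(k,s)$ and $M(k)$ denote random variables distributed as $M$ conditionally on $\{X_0=k,S_0=s\}$ and on $\{X_0=k\}$ respectively, and let $I(s)=1$ if $T_1<s$ and $I(s)=0$ otherwise. Then for $k\geq1$ and $s\geq 0$, $$M(k,s)=_d I(s)\max\{M+k;\,M(k,s)\}+(1-I(s))\max\{k,M(k-1)\},$$ where $M(0)=0$, and $I(s)$, $M$, $M(k,s)$ and $M(k-1)$ on the right-hand side are independent.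
   Context: Under LCFS-p-repeat-without-resampling, the customer who has been in the system the least amount of time is always served, newly arriving customers preempt the customer in service (customers within a batch are labeled arbitrarily and treated as arriving sequentially), service is non-idling, and a preempted service must be restarted from scratch when service recommences, but each customer's total service requirement is drawn only once and is the same each time it restarts. $Y=_dZ$ denotes equality in distribution. *)

theory Defs
  imports "HOL-Probability.Probability"
begin

text \<open>Model of one busy period of an M^X/G/1 queue under LCFS-p-repeat-without-resampling.
  Input sample omega n = (T n, B n, D n), independent over n:
  T 0 is the first interarrival time after the busy period starts (T_1 of the paper),
  batch n+1 arrives at time T 0 + ... + T n; batch 0 arrives at time 0 and starts the busy period;
  B n is the size of batch n; D n j is the (once drawn) service requirement of customer j of batch n.
  Within a batch customers are treated as arriving sequentially, customer (n,0) being the last,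
  hence it is on top of the LCFS stack.\<close>

type_synonym inp = "nat \<Rightarrow> real \<times> nat \<times> (nat \<Rightarrow> real)"

definition arr :: "inp \<Rightarrow> nat \<Rightarrow> real" where
  "arr \<omega> n = (\<Sum>i<n. fst (\<omega> i))"

definition bsz :: "inp \<Rightarrow> nat \<Rightarrow> nat" where
  "bsz \<omega> n = fst (snd (\<omega> n))"

definition svc :: "inp \<Rightarrow> nat \<times> nat \<Rightarrow> real" where
  "svc \<omega> c = snd (snd (\<omega> (fst c))) (snd c)"

definition batch :: "inp \<Rightarrow> nat \<Rightarrow> (nat \<times> nat) list" where
  "batch \<omega> n = map (\<lambda>j. (n, j)) [0..<bsz \<omega> n]"

text \<open>State: (stack of customers, head = customer in service; start time of the current
  service attempt; index of the next batch to arrive).  An arrival strictly before the completion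
  time preempts; a preempted customer restarts its (same) requirement from scratch.\<close>

definition step :: "inp \<Rightarrow> (nat \<times> nat) list \<times> real \<times> nat \<Rightarrow> (nat \<times> nat) list \<times> real \<times> nat" where
  "step \<omega> st = (case st of (cs, \<sigma>, n) \<Rightarrow>
     if cs = [] then (cs, \<sigma>, n)
     else (let f = \<sigma> + svc \<omega> (hd cs) in
           if arr \<omega> n < f then (batch \<omega> n @ cs, arr \<omega> n, Suc n)
           else (tl cs, f, n)))"

definition init :: "inp \<Rightarrow> (nat \<times> nat) list \<times> real \<times> nat" where
  "init \<omega> = (batch \<omega> 0, 0, 1)"

definition maxQ :: "inp \<Rightarrow> enat" where
  "maxQ \<omega> = (SUP m. enat (length (fst ((step \<omega> ^^ m) (init \<omega>)))))"

definition inputM :: "real \<Rightarrow> nat pmf \<Rightarrow> real measure \<Rightarrow> inp measure" where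
  "inputM lam \<beta> Sd = PiM UNIV (\<lambda>_. density lborel (exponential_density lam)
        \<Otimes>\<^sub>M (measure_pmf \<beta> \<Otimes>\<^sub>M PiM UNIV (\<lambda>_. Sd)))"

definition setX0 :: "nat \<Rightarrow> inp \<Rightarrow> inp" where
  "setX0 k \<omega> = fun_upd \<omega> 0 (fst (\<omega> 0), k, snd (snd (\<omega> 0)))"

definition setS0 :: "real \<Rightarrow> inp \<Rightarrow> inp" where
  "setS0 s \<omega> = fun_upd \<omega> 0 (fst (\<omega> 0), fst (snd (\<omega> 0)), fun_upd (snd (snd (\<omega> 0))) 0 s)"

definition lawM :: "real \<Rightarrow> nat pmf \<Rightarrow> real measure \<Rightarrow> enat measure" where
  "lawM lam \<beta> Sd = distr (inputM lam \<beta> Sd) (count_space UNIV) maxQ"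

definition lawMk :: "real \<Rightarrow> nat pmf \<Rightarrow> real measure \<Rightarrow> nat \<Rightarrow> enat measure" where
  "lawMk lam \<beta> Sd k = (if k = 0 then return (count_space UNIV) 0
     else distr (inputM lam \<beta> Sd) (count_space UNIV) (\<lambda>\<omega>. maxQ (setX0 k \<omega>)))"

definition lawMks :: "real \<Rightarrow> nat pmf \<Rightarrow> real measure \<Rightarrow> nat \<Rightarrow> real \<Rightarrow> enat measure" where
  "lawMks lam \<beta> Sd k s = distr (inputM lam \<beta> Sd) (count_space UNIV)
     (\<lambda>\<omega>. maxQ (setS0 s (setX0 k \<omega>)))"

definition lawI :: "real \<Rightarrow> nat pmf \<Rightarrow> real measure \<Rightarrow> real \<Rightarrow> bool measure" where
  "lawI lam \<beta> Sd s = distr (inputM lam \<beta> Sd) (count_space UNIV) (\<lambda>\<omega>. fst (\<omega> 0) < s)"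

end

(* Only the LCFS stack, the residual interarrival time and the not yet consumed input matter, and by
   memorylessness the residual interarrival time is fresh at every service completion.  Hence the
   probability that a stack is emptied without its height ever exceeding x depends on the stack
   alone, and for a stack a on top of a stack b of height k it is the product of the probability
   for a with bound x - k and the probability for b with bound x.  Conditioning on the first event
   (arrival or service completion) then gives the recursion for the distribution functions.

   These emptying probabilities are the distribution function of the maximum only because a busy
   period whose height stays bounded ends almost surely.  If services exceed 1 with positive
   probability, arbitrarily long runs of preempting arrivals occur and the height is unbounded;
   otherwise the work in a bounded stack is bounded, and a long enough interarrival time empties it. *)

theory Submission
  imports Defs
begin

section \<open>The busy period as a process on stacks of service requirements\<close>

text \<open>A state consists of the height of the stack, the service requirements from the top downwards
  (entries beyond the height are junk), the time from the start of the current service attempt to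
  the next arrival, and the remaining input \<open>w\<close>: the next arriving batch is \<open>w 0\<close>, whose first
  component is the gap after that arrival.\<close>

type_synonym busy = "nat \<times> (nat \<Rightarrow> real) \<times> real \<times> inp"

text \<open>Keeping the residual gap instead of absolute times gives the state after each event the
  form of a starting state, as memorylessness requires. \<open>comb_seq\<close> puts the new batch
  on top; the preempted requirement stays in the sequence unchanged.\<close>

definition bstep :: "busy \<Rightarrow> busy" where
  "bstep = (\<lambda>(h, f, r, w).
     if h = 0 then (h, f, r, w)
     else if r < f 0
       then (h + fst (snd (w 0)), comb_seq (fst (snd (w 0))) (snd (snd (w 0))) f, fst (w 0), \<lambda>i. w (Suc i))
     else (h - 1, \<lambda>i. f (Suc i), r - f 0, w))"

definition height :: "busy \<Rightarrow> nat \<Rightarrow> nat" where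
  "height st m = fst ((bstep ^^ m) st)"

definition peak :: "busy \<Rightarrow> enat" where
  "peak st = (SUP m. enat (height st m))"

lemma bstep_empty [simp]: "bstep (0, f, r, w) = (0, f, r, w)"
  by (simp add: bstep_def)

lemma bstep_push:
  "0 < h \<Longrightarrow> r < f 0 \<Longrightarrow> bstep (h, f, r, w) =
     (h + fst (snd (w 0)), comb_seq (fst (snd (w 0))) (snd (snd (w 0))) f, fst (w 0), \<lambda>i. w (Suc i))"
  by (simp add: bstep_def)

lemma bstep_pop:
  "0 < h \<Longrightarrow> \<not> r < f 0 \<Longrightarrow> bstep (h, f, r, w) = (h - 1, \<lambda>i. f (Suc i), r - f 0, w)"
  by (simp add: bstep_def)

lemma height_0 [simp]: "height st 0 = fst st"
  by (simp add: height_def)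

lemma height_Suc: "height st (Suc m) = height (bstep st) m"
  by (simp add: height_def funpow_swap1)

lemma height_add: "height st (m + n) = height ((bstep ^^ m) st) n"
  by (simp add: height_def funpow_add add.commute[of m n])

lemma height_empty [simp]: "height (0, f, r, w) m = 0"
  by (induction m) (simp_all add: height_Suc)

lemma height_stays_0: "height st m = 0 \<Longrightarrow> m \<le> n \<Longrightarrow> height st n = 0"
proof -
  assume *: "height st m = 0" "m \<le> n"
  obtain f r w where "(bstep ^^ m) st = (0, f, r, w)"
    using *(1) by (cases "(bstep ^^ m) st") (auto simp: height_def)
  then show ?thesis
    using height_add[of st m "n - m"] *(2) by simp
qed

lemma peak_le_iff: "peak st \<le> enat x \<longleftrightarrow> (\<forall>m. height st m \<le> x)"
  by (simp add: peak_def SUP_le_iff)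

lemma peak_empty [simp]: "peak (0, f, r, w) = 0"
  by (simp add: peak_def zero_enat_def[symmetric])

section \<open>Agreement with the queue of labelled customers\<close>

definition models :: "inp \<Rightarrow> (nat \<times> nat) list \<times> real \<times> nat \<Rightarrow> busy \<Rightarrow> bool" where
  "models \<omega> = (\<lambda>(cs, \<sigma>, n) (h, f, r, w).
     h = length cs \<and> (\<forall>i<h. f i = svc \<omega> (cs ! i)) \<and> r = arr \<omega> n - \<sigma> \<and> w = (\<lambda>i. \<omega> (n + i)))"

text \<open>The residual gap is the next arrival epoch minus the start of the current attempt, so
  both processes see the same event at each step.\<close>

lemma models_step: "models \<omega> st bs \<Longrightarrow> models \<omega> (step \<omega> st) (bstep bs)"
proof -
  assume *: "models \<omega> st bs"
  obtain cs \<sigma> n h f r w where st: "st = (cs, \<sigma>, n)" and bs: "bs = (h, f, r, w)"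
    by (metis prod_cases3 surj_pair)
  from * have m: "h = length cs" "\<And>i. i < h \<Longrightarrow> f i = svc \<omega> (cs ! i)" "r = arr \<omega> n - \<sigma>"
      "w = (\<lambda>i. \<omega> (n + i))"
    by (auto simp: models_def st bs)
  show ?thesis
  proof (cases cs)
    case Nil
    then show ?thesis using * m by (simp add: st bs step_def bstep_def)
  next
    case (Cons c cs')
    have f0: "f 0 = svc \<omega> c" using m(2)[of 0] by (simp add: m(1) Cons)
    have fS: "f (Suc i) = svc \<omega> (cs' ! i)" if "i < length cs'" for i
      using m(2)[of "Suc i"] that by (simp add: m(1) Cons)
    have fC: "f i = svc \<omega> ((c # cs') ! i)" if "i < Suc (length cs')" for i
      using m(2)[of i] that by (simp add: m(1) Cons)
    have iff: "r < f 0 \<longleftrightarrow> arr \<omega> n < \<sigma> + svc \<omega> c" by (auto simp: m(3) f0)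
    show ?thesis
    proof (cases "r < f 0")
      case True
      have "comb_seq (bsz \<omega> n) (snd (snd (\<omega> n))) f i = svc \<omega> ((batch \<omega> n @ c # cs') ! i)"
        if "i < bsz \<omega> n + Suc (length cs')" for i
        using that fC[of "i - bsz \<omega> n"]
        by (auto simp: comb_seq_def batch_def nth_append svc_def)
      then show ?thesis using True iff
        by (auto simp: models_def st bs step_def bstep_def Cons m(1,4) Let_def arr_def bsz_def batch_def)
    next
      case False
      then show ?thesis using iff fS
        by (auto simp: models_def st bs step_def bstep_def Cons m(1,3,4) Let_def f0)
    qed
  qed
qed

lemma models_funpow: "models \<omega> st bs \<Longrightarrow> models \<omega> ((step \<omega> ^^ m) st) ((bstep ^^ m) bs)"
  by (induction m) (simp_all add: models_step)

lemma models_length: "models \<omega> st bs \<Longrightarrow> length (fst st) = fst bs"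
  by (auto simp: models_def)

text \<open>The processes run in lockstep. Batch 0 is on the stack from the start and its first
  component is the gap until batch 1, with which the remaining input begins.\<close>

lemma maxQ_eq_peak:
  "maxQ \<omega> = peak (fst (snd (\<omega> 0)), snd (snd (\<omega> 0)), fst (\<omega> 0), \<lambda>i. \<omega> (Suc i))" (is "_ = peak ?bs")
proof -
  have m: "models \<omega> (init \<omega>) ?bs"
    by (auto simp: models_def init_def batch_def bsz_def svc_def arr_def)
  have "length (fst ((step \<omega> ^^ m) (init \<omega>))) = height ?bs m" for m
    using models_length[OF models_funpow[OF m]] by (simp add: height_def)
  then show ?thesis
    by (simp add: maxQ_def peak_def)
qed

text \<open>All remaining work fits into the current gap, so each of the next \<open>h\<close>
  events is a completion; each consumes at most \<open>c\<close> of the gap, which preserves the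
  bound.\<close>

lemma bounded_work_ends:
  assumes "0 \<le> c" "\<forall>i<h. f i \<le> c" "real h * c \<le> r"
  shows "height (h, f, r, w) h = 0"
  using assms(2,3)
proof (induction h arbitrary: f r)
  case (Suc h)
  have "f 0 \<le> c" "\<forall>i<h. f (Suc i) \<le> c" using Suc.prems(1) by auto
  moreover have "real h * c \<le> r - f 0" if "\<not> r < f 0"
    using Suc.prems(2) \<open>f 0 \<le> c\<close> by (simp add: algebra_simps)
  moreover have "\<not> r < f 0"
  proof -
    have "0 \<le> real h * c" using assms(1) by simp
    then show ?thesis using Suc.prems(2) \<open>f 0 \<le> c\<close> by (simp add: algebra_simps)
  qed
  ultimately show ?case
    using Suc.IH[of "\<lambda>i. f (Suc i)" "r - f 0"] by (simp add: height_Suc bstep_pop)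
qed simp

section \<open>Busy periods that do not end\<close>

text \<open>The state just after the arrival of \<open>w 0\<close>. No residual gap is passed in,
  since an arrival starts a new attempt.\<close>

definition arrive :: "nat \<Rightarrow> (nat \<Rightarrow> real) \<Rightarrow> inp \<Rightarrow> busy" where
  "arrive h f w = (h + fst (snd (w 0)), comb_seq (fst (snd (w 0))) (snd (snd (w 0))) f, fst (w 0), \<lambda>i. w (Suc i))"

text \<open>Completions alone would empty the stack after \<open>h\<close> steps.\<close>

lemma arrival_occurs:
  assumes "\<forall>m. height (h, f, r, w) m \<noteq> 0"
  shows "\<exists>m h' f'. (bstep ^^ m) (h, f, r, w) = arrive h' f' w"
  using assms
proof (induction h arbitrary: f r)
  case 0
  then show ?case by simp
next
  case (Suc h)
  show ?case
  proof (cases "r < f 0")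
    case True
    then have "(bstep ^^ 1) (Suc h, f, r, w) = arrive (Suc h) f w"
      by (simp add: bstep_push arrive_def)
    then show ?thesis by blast
  next
    case False
    have "\<forall>m. height (h, \<lambda>i. f (Suc i), r - f 0, w) m \<noteq> 0"
      using Suc.prems False by (metis height_Suc bstep_pop zero_less_Suc diff_Suc_1)
    from Suc.IH[OF this] obtain m h' f'
      where "(bstep ^^ m) (h, \<lambda>i. f (Suc i), r - f 0, w) = arrive h' f' w" by blast
    then have "(bstep ^^ Suc m) (Suc h, f, r, w) = arrive h' f' w"
      using False by (simp add: funpow_swap1 bstep_pop)
    then show ?thesis by blast
  qed
qed

text \<open>Iterates \<open>arrival_occurs\<close>: the state after each arrival again belongs to a
  period that never ends.\<close>

lemma all_arrivals_occur:
  assumes "\<forall>m. height (h, f, r, w) m \<noteq> 0"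
  shows "\<exists>m h' f'. (bstep ^^ m) (h, f, r, w) = arrive h' f' (\<lambda>i. w (n + i))"
proof (induction n)
  case 0
  then show ?case using arrival_occurs[OF assms] by simp
next
  case (Suc n)
  then obtain m h' f' where m: "(bstep ^^ m) (h, f, r, w) = arrive h' f' (\<lambda>i. w (n + i))" by blast
  have "\<forall>k. height (arrive h' f' (\<lambda>i. w (n + i))) k \<noteq> 0"
    using assms m height_add by metis
  from arrival_occurs[OF this[unfolded arrive_def]] obtain k h'' f''
    where "(bstep ^^ k) (arrive h' f' (\<lambda>i. w (n + i))) = arrive h'' f'' (\<lambda>i. w (n + Suc i))"
    unfolding arrive_def by blast
  then have "(bstep ^^ (k + m)) (h, f, r, w) = arrive h'' f'' (\<lambda>i. w (Suc n + i))"
    by (simp add: funpow_add m)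
  then show ?case by blast
qed

text \<open>The customer on top of such a batch needs longer than the following gap, so the next
  arrival is sure to preempt.\<close>

definition preempting :: "real \<times> nat \<times> (nat \<Rightarrow> real) \<Rightarrow> bool" where
  "preempting = (\<lambda>(t, b, d). t < 1 \<and> 1 \<le> b \<and> 1 < d 0)"

text \<open>Each entry of the run adds at least one customer and forces the next event to be an
  arrival.\<close>

lemma preempting_run_height:
  "\<forall>i<N. preempting (w i) \<Longrightarrow> h + N \<le> height (arrive h f w) N"
proof (induction N arbitrary: h f w)
  case 0
  then show ?case by (simp add: arrive_def)
next
  case (Suc N)
  have p: "fst (w 0) < 1" "1 \<le> fst (snd (w 0))" "1 < snd (snd (w 0)) 0"
    using Suc.prems[rule_format, of 0] by (auto simp: preempting_def case_prod_beta)
  then have st: "bstep (arrive h f w) =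
      arrive (h + fst (snd (w 0))) (comb_seq (fst (snd (w 0))) (snd (snd (w 0))) f) (\<lambda>i. w (Suc i))"
    unfolding arrive_def by (subst bstep_push) (auto simp: comb_seq_def)
  have "\<forall>i<N. preempting (w (Suc i))" using Suc.prems by simp
  from Suc.IH[OF this, of "h + fst (snd (w 0))" "comb_seq (fst (snd (w 0))) (snd (snd (w 0))) f"] p(2)
  show ?case
    by (simp add: height_Suc st)
qed

text \<open>In a period that never ends every batch arrives, so a run of length \<open>Suc x\<close>
  anywhere in the input would push the height above \<open>x\<close>.\<close>

lemma preempting_runs_end_or_exceed:
  assumes "\<forall>m. height (h, f, r, w) m \<noteq> 0" and "\<forall>m. height (h, f, r, w) m \<le> x"
  shows "\<not> (\<forall>i<Suc x. preempting (w (n + i)))"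
proof
  assume run: "\<forall>i<Suc x. preempting (w (n + i))"
  obtain m h' f' where m: "(bstep ^^ m) (h, f, r, w) = arrive h' f' (\<lambda>i. w (n + i))"
    using all_arrivals_occur[OF assms(1)] by blast
  have "h' + Suc x \<le> height (arrive h' f' (\<lambda>i. w (n + i))) (Suc x)"
    using preempting_run_height[OF run] .
  also have "\<dots> = height (h, f, r, w) (m + Suc x)"
    by (simp only: height_add m)
  also have "\<dots> \<le> x" using assms(2) by blast
  finally show False by simp
qed

text \<open>Bounding the requirements still to arrive as well makes this an invariant of
  \<open>bstep\<close>.\<close>

definition work_le :: "real \<Rightarrow> busy \<Rightarrow> bool" where
  "work_le c = (\<lambda>(h, f, r, w). (\<forall>i<h. f i \<le> c) \<and> (\<forall>n i. snd (snd (w n)) i \<le> c))"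

lemma work_le_bstep: "work_le c st \<Longrightarrow> work_le c (bstep st)"
  by (auto simp: work_le_def bstep_def comb_seq_def split: prod.splits)

lemma work_le_funpow: "work_le c st \<Longrightarrow> work_le c ((bstep ^^ m) st)"
  by (induction m) (simp_all add: work_le_bstep)

text \<open>Batch \<open>n\<close> does arrive, and at most \<open>x\<close> customers needing at
  most \<open>c\<close> each are then present; a gap of \<open>x * c\<close> would suffice to serve
  them all.\<close>

lemma bounded_work_no_long_gap:
  assumes "0 \<le> c" and "work_le c (h, f, r, w)"
    and "\<forall>m. height (h, f, r, w) m \<noteq> 0" and "\<forall>m. height (h, f, r, w) m \<le> x"
  shows "fst (w n) < real x * c"
proof (rule ccontr)
  assume "\<not> ?thesis"
  then have big: "real x * c \<le> fst (w n)" by simp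
  obtain m h' f' where m: "(bstep ^^ m) (h, f, r, w) = arrive h' f' (\<lambda>i. w (n + i))"
    using all_arrivals_occur[OF assms(3)] by blast
  obtain h'' f'' w'' where a: "arrive h' f' (\<lambda>i. w (n + i)) = (h'', f'', fst (w n), w'')"
    by (simp add: arrive_def)
  have "height (h, f, r, w) m = h''" by (simp add: height_def m a)
  then have "h'' \<le> x" using assms(4) by metis
  then have "real h'' * c \<le> fst (w n)"
    using big assms(1) by (meson mult_right_mono of_nat_mono order_trans)
  moreover have "\<forall>i<h''. f'' i \<le> c"
    using work_le_funpow[OF assms(2), of m] by (simp add: m a work_le_def)
  ultimately have "height (h'', f'', fst (w n), w'') h'' = 0"
    using assms(1) bounded_work_ends by blast
  then have "height (h, f, r, w) (m + h'') = 0" by (simp only: height_add m a)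
  then show False using assms(3) by blast
qed

section \<open>Measurability and the input measure\<close>

text \<open>With Borel versions of the spaces, measurability of the dynamics is settled once,
  without reference to the laws of the input.\<close>

abbreviation seqB :: "(nat \<Rightarrow> real) measure" where
  "seqB \<equiv> \<Pi>\<^sub>M i\<in>UNIV. borel"

abbreviation inpB :: "inp measure" where
  "inpB \<equiv> \<Pi>\<^sub>M i\<in>UNIV. borel \<Otimes>\<^sub>M (count_space UNIV \<Otimes>\<^sub>M seqB)"

abbreviation busyB :: "busy measure" where
  "busyB \<equiv> count_space UNIV \<Otimes>\<^sub>M (seqB \<Otimes>\<^sub>M (borel \<Otimes>\<^sub>M inpB))"

lemma space_seqB [simp]: "space seqB = UNIV"
  by (simp add: space_PiM)

text \<open>The random cut point takes countably many values, so measurability for each fixed cut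
  point is enough.\<close>

lemma measurable_comb_seq_random [measurable (raw)]:
  assumes [measurable]: "n \<in> N \<rightarrow>\<^sub>M count_space UNIV" "f \<in> N \<rightarrow>\<^sub>M PiM UNIV (\<lambda>_. M)" "g \<in> N \<rightarrow>\<^sub>M PiM UNIV (\<lambda>_. M)"
  shows "(\<lambda>x. comb_seq (n x) (f x) (g x)) \<in> N \<rightarrow>\<^sub>M PiM UNIV (\<lambda>_. M)"
  by (rule measurable_compose_countable[OF _ assms(1)]) measurable

lemma measurable_shift [measurable (raw)]:
  assumes [measurable]: "f \<in> N \<rightarrow>\<^sub>M PiM UNIV (\<lambda>_. M)"
  shows "(\<lambda>x i. f x (Suc i)) \<in> N \<rightarrow>\<^sub>M PiM (UNIV :: nat set) (\<lambda>_. M)"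
  by (rule measurable_abs_UNIV) measurable

lemma measurable_bstep [measurable]: "bstep \<in> busyB \<rightarrow>\<^sub>M busyB"
  unfolding bstep_def split_beta by measurable

lemma measurable_height [measurable]: "(\<lambda>st. height st m) \<in> busyB \<rightarrow>\<^sub>M count_space UNIV"
  unfolding height_def by measurable

lemma measurable_peak [measurable]: "peak \<in> busyB \<rightarrow>\<^sub>M count_space UNIV"
  unfolding peak_def by measurable

locale mxg1 =
  fixes lam :: real and \<beta> :: "nat pmf" and Sd :: "real measure"
  assumes lam_pos: "0 < lam"
    and prob_space_Sd: "prob_space Sd" and sets_Sd [measurable_cong]: "sets Sd = sets borel"
    and Sd_nonneg: "AE x in Sd. 0 \<le> x"
    and batch_pos: "set_pmf \<beta> \<subseteq> {1..}"
begin

abbreviation E :: "real measure" where "E \<equiv> density lborel (exponential_density lam)"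
abbreviation DS :: "(nat \<Rightarrow> real) measure" where "DS \<equiv> \<Pi>\<^sub>M i\<in>UNIV. Sd"
abbreviation X :: "(real \<times> nat \<times> (nat \<Rightarrow> real)) measure" where "X \<equiv> E \<Otimes>\<^sub>M (measure_pmf \<beta> \<Otimes>\<^sub>M DS)"
abbreviation IN :: "inp measure" where "IN \<equiv> \<Pi>\<^sub>M i\<in>UNIV. X"

lemma inputM_eq: "inputM lam \<beta> Sd = IN"
  by (simp add: inputM_def)

sublocale Sd: prob_space Sd by (rule prob_space_Sd)
sublocale E: prob_space E by (rule prob_space_exponential_density[OF lam_pos])
sublocale D: sequence_space Sd by standard
sublocale BD: pair_prob_space "measure_pmf \<beta>" DS by standard
sublocale X: pair_prob_space E "measure_pmf \<beta> \<Otimes>\<^sub>M DS" by standard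
sublocale W: sequence_space X by standard

lemma sets_DS [measurable_cong]: "sets DS = sets seqB"
  by (intro sets_PiM_cong refl) (simp add: sets_Sd)

lemma sets_X [measurable_cong]: "sets X = sets (borel \<Otimes>\<^sub>M (count_space UNIV \<Otimes>\<^sub>M seqB))"
  by (intro sets_pair_measure_cong sets_DS) simp_all

lemma sets_IN [measurable_cong]: "sets IN = sets inpB"
  by (intro sets_PiM_cong refl sets_X)

lemma space_Sd [simp]: "space Sd = UNIV"
  using sets_eq_imp_space_eq[OF sets_Sd] by simp

lemma space_DS [simp]: "space DS = UNIV"
  using sets_eq_imp_space_eq[OF sets_DS] by (simp add: space_PiM)

lemma space_X [simp]: "space X = UNIV"
  using sets_eq_imp_space_eq[OF sets_X] by (simp add: space_PiM space_pair_measure)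

lemma space_IN [simp]: "space IN = UNIV"
  using sets_eq_imp_space_eq[OF sets_IN] by (simp add: space_PiM space_pair_measure)

text \<open>An i.i.d. sequence is its first entry followed by an independent copy of itself.\<close>

lemma nn_integral_IN_split:
  assumes [measurable]: "g \<in> borel_measurable inpB"
  shows "(\<integral>\<^sup>+w. g w \<partial>IN) = (\<integral>\<^sup>+x. \<integral>\<^sup>+w. g (case_nat x w) \<partial>IN \<partial>X)"
proof -
  have "(\<integral>\<^sup>+w. g w \<partial>IN) = (\<integral>\<^sup>+w. g w \<partial>distr (X \<Otimes>\<^sub>M IN) IN (\<lambda>(s, w). case_nat s w))"
    by (simp add: W.PiM_iter)
  also have "\<dots> = (\<integral>\<^sup>+y. g (case y of (s, w) \<Rightarrow> case_nat s w) \<partial>(X \<Otimes>\<^sub>M IN))"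
    by (rule nn_integral_distr) measurable
  also have "\<dots> = (\<integral>\<^sup>+x. \<integral>\<^sup>+w. g (case_nat x w) \<partial>IN \<partial>X)"
    by (subst W.nn_integral_fst[symmetric]) simp_all
  finally show ?thesis .
qed

text \<open>The gap is integrated innermost, so that for a fixed batch the integral has the shape
  occurring in \<open>prob_ended\<close>.\<close>

lemma nn_integral_X_split:
  assumes [measurable]: "g \<in> borel_measurable (borel \<Otimes>\<^sub>M (count_space UNIV \<Otimes>\<^sub>M seqB))"
  shows "(\<integral>\<^sup>+x. g x \<partial>X) = (\<integral>\<^sup>+b. \<integral>\<^sup>+d. \<integral>\<^sup>+t. g (t, b, d) \<partial>E \<partial>DS \<partial>measure_pmf \<beta>)"
proof -
  have "(\<integral>\<^sup>+x. g x \<partial>X) = (\<integral>\<^sup>+y. \<integral>\<^sup>+t. g (t, y) \<partial>E \<partial>(measure_pmf \<beta> \<Otimes>\<^sub>M DS))"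
    by (rule X.nn_integral_snd[symmetric]) measurable
  also have "\<dots> = (\<integral>\<^sup>+b. \<integral>\<^sup>+d. \<integral>\<^sup>+t. g (t, b, d) \<partial>E \<partial>DS \<partial>measure_pmf \<beta>)"
    by (subst D.nn_integral_fst[symmetric]) simp_all
  finally show ?thesis .
qed

lemma nn_integral_DS_split:
  assumes [measurable]: "g \<in> borel_measurable seqB"
  shows "(\<integral>\<^sup>+d. g d \<partial>DS) = (\<integral>\<^sup>+x. \<integral>\<^sup>+d. g (case_nat x d) \<partial>DS \<partial>Sd)"
proof -
  have "(\<integral>\<^sup>+w. g w \<partial>DS) = (\<integral>\<^sup>+w. g w \<partial>distr (Sd \<Otimes>\<^sub>M DS) DS (\<lambda>(s, w). case_nat s w))"
    by (simp add: D.PiM_iter)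
  also have "\<dots> = (\<integral>\<^sup>+y. g (case y of (s, w) \<Rightarrow> case_nat s w) \<partial>(Sd \<Otimes>\<^sub>M DS))"
    by (rule nn_integral_distr) measurable
  also have "\<dots> = (\<integral>\<^sup>+x. \<integral>\<^sup>+d. g (case_nat x d) \<partial>DS \<partial>Sd)"
    by (subst D.nn_integral_fst[symmetric]) simp_all
  finally show ?thesis .
qed

lemma AE_DS_nonneg: "AE d in DS. \<forall>i. 0 \<le> d i"
  unfolding AE_all_countable
proof
  fix i show "AE d in DS. 0 \<le> d i"
    using AE_PiM_component[of UNIV "\<lambda>_. Sd" i "\<lambda>x. 0 \<le> x"] prob_space_Sd Sd_nonneg by simp
qed

end

section \<open>Emptying probabilities\<close>

text \<open>The step bound \<open>m\<close> makes a first-step recursion possible; the events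
  increase with \<open>m\<close>.\<close>

definition ended :: "nat \<Rightarrow> nat \<Rightarrow> busy \<Rightarrow> bool" where
  "ended x m st \<longleftrightarrow> height st m = 0 \<and> (\<forall>j\<le>m. height st j \<le> x)"

lemma measurable_ended [measurable]: "Measurable.pred busyB (ended x m)"
  unfolding ended_def by measurable

lemma ended_0: "ended x 0 (h, f, r, w) \<longleftrightarrow> h = 0"
  by (auto simp: ended_def)

lemma ended_Suc: "ended x (Suc m) st \<longleftrightarrow> fst st \<le> x \<and> ended x m (bstep st)"
proof -
  have "(\<forall>j\<le>Suc m. height st j \<le> x) \<longleftrightarrow> height st 0 \<le> x \<and> (\<forall>j\<le>m. height st (Suc j) \<le> x)"
    by (metis Suc_le_mono le0 not0_implies_Suc)
  then show ?thesis
    by (auto simp: ended_def height_Suc)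
qed

lemma ended_mono: "ended x m st \<Longrightarrow> m \<le> n \<Longrightarrow> ended x n st"
  unfolding ended_def by (metis height_stays_0 le0 nle_le)

lemma ended_empty [simp]: "ended x m (0, f, r, w)"
  by (simp add: ended_def)

text \<open>The limit event is a bounded peak together with termination;
  \<open>AE_bounded_ends\<close> later shows that the former almost surely implies the
  latter.\<close>

lemma ex_ended_iff: "(\<exists>m. ended x m st) \<longleftrightarrow> (\<exists>m. height st m = 0) \<and> peak st \<le> enat x"
  unfolding peak_le_iff ended_def by (metis height_stays_0 le0 nle_le)

text \<open>With \<open>comb_seq_tail\<close> this says that arrivals and completions in the upper
  part of a split stack change only that part.\<close>

lemma comb_seq_assoc: "comb_seq b d' (comb_seq h d f) = comb_seq (b + h) (comb_seq b d' d) f"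
  by (auto simp: comb_seq_def fun_eq_iff)

lemma comb_seq_tail: "0 < h \<Longrightarrow> (\<lambda>i. comb_seq h d f (Suc i)) = comb_seq (h - 1) (\<lambda>i. d (Suc i)) f"
  by (auto simp: comb_seq_def fun_eq_iff less_diff_conv)

context mxg1
begin

lemma emeasure_UNIV [simp]: "emeasure Sd UNIV = 1" "emeasure DS UNIV = 1" "emeasure IN UNIV = 1" 
    "emeasure E UNIV = 1" "emeasure X UNIV = 1"
  using Sd.emeasure_space_1 D.emeasure_space_1 W.emeasure_space_1 E.emeasure_space_1 X.emeasure_space_1
  by simp_all

section \<open>Exponential interarrival times\<close>

definition arrival_prob :: "real \<Rightarrow> ennreal" where
  "arrival_prob a = (\<integral>\<^sup>+t. (if t < a then 1 else 0) \<partial>E)"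

definition service_prob :: "real \<Rightarrow> ennreal" where
  "service_prob a = (\<integral>\<^sup>+t. (if t < a then 0 else 1) \<partial>E)"

lemma measurable_arrival_prob [measurable]: "arrival_prob \<in> borel_measurable borel"
  unfolding arrival_prob_def by measurable

lemma measurable_service_prob [measurable]: "service_prob \<in> borel_measurable borel"
  unfolding service_prob_def by measurable

text \<open>Shift the integration variable by \<open>a\<close>: for \<open>t\<close> at least 0, the
  density at \<open>a + t\<close> is \<open>exp (- lam * a)\<close> times the density at
  \<open>t\<close>.\<close>

lemma exp_residual:
  assumes "0 \<le> a" and [measurable]: "C \<in> borel_measurable borel"
  shows "(\<integral>\<^sup>+t. (if t < a then 0 else C (t - a)) \<partial>E) = ennreal (exp (- lam * a)) * (\<integral>\<^sup>+t. C t \<partial>E)"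
proof -
  have "(\<integral>\<^sup>+t. (if t < a then 0 else C (t - a)) \<partial>E) =
      (\<integral>\<^sup>+t. ennreal (exponential_density lam t) * (if t < a then 0 else C (t - a)) \<partial>lborel)"
    by (rule nn_integral_density) measurable
  also have "\<dots> = (\<integral>\<^sup>+t. ennreal (exponential_density lam (a + 1 * t)) *
      (if a + 1 * t < a then 0 else C (a + 1 * t - a)) \<partial>lborel)"
    by (subst nn_integral_real_affine[of _ 1 a]) auto
  also have "\<dots> = (\<integral>\<^sup>+t. ennreal (exp (- lam * a)) * (ennreal (exponential_density lam t) * C t) \<partial>lborel)"
  proof (rule nn_integral_cong)
    fix t :: real
    have "ennreal (exponential_density lam (a + t)) = ennreal (exp (- lam * a)) * ennreal (exponential_density lam t)"
      if "0 \<le> t"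
      using that assms(1) lam_pos
      by (simp add: exponential_density_def ennreal_mult[symmetric] mult_exp_exp algebra_simps)
    \<comment> \<open>For negative \<open>t\<close> both integrands vanish, the left one through the
      \<open>if\<close>, the right one through the density.\<close>
    moreover have "exponential_density lam t = 0" if "t < 0"
      using that by (simp add: exponential_density_def)
    ultimately show "ennreal (exponential_density lam (a + 1 * t)) * (if a + 1 * t < a then 0 else C (a + 1 * t - a)) =
        ennreal (exp (- lam * a)) * (ennreal (exponential_density lam t) * C t)"
      by (cases "t < 0") (simp_all add: mult.assoc)
  qed
  also have "\<dots> = ennreal (exp (- lam * a)) * (\<integral>\<^sup>+t. ennreal (exponential_density lam t) * C t \<partial>lborel)"
    by (rule nn_integral_cmult) measurable
  also have "(\<integral>\<^sup>+t. ennreal (exponential_density lam t) * C t \<partial>lborel) = (\<integral>\<^sup>+t. C t \<partial>E)"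
    by (rule nn_integral_density[symmetric]) measurable
  finally show ?thesis .
qed

lemma service_prob_eq: "0 \<le> a \<Longrightarrow> service_prob a = ennreal (exp (- lam * a))"
  using exp_residual[of a "\<lambda>_. 1"] by (simp add: service_prob_def)

lemma memoryless:
  "0 \<le> a \<Longrightarrow> C \<in> borel_measurable borel \<Longrightarrow>
    (\<integral>\<^sup>+t. (if t < a then 0 else C (t - a)) \<partial>E) = service_prob a * (\<integral>\<^sup>+t. C t \<partial>E)"
  by (simp add: exp_residual service_prob_eq)

lemma arrival_prob_pos: "0 < a \<Longrightarrow> 0 < arrival_prob a"
proof -
  assume a: "0 < a"
  have "arrival_prob a + service_prob a = (\<integral>\<^sup>+t. (if t < a then 1 else 0) + (if t < a then 0 else 1) \<partial>E)"
    unfolding arrival_prob_def service_prob_def by (rule nn_integral_add[symmetric]) measurable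
  also have "\<dots> = (\<integral>\<^sup>+t. 1 \<partial>E)" by (rule nn_integral_cong) simp
  finally have "arrival_prob a + service_prob a = 1" by simp
  moreover have "service_prob a < 1" using a lam_pos by (simp add: service_prob_eq ennreal_less_one_iff)
  ultimately show ?thesis by (metis add_0 less_irrefl not_gr_zero)
qed

text \<open>The residual gap and the future input are integrated out, so only the stack remains as
  argument. After an arrival the interrupted requirement \<open>f 0\<close> is still in
  \<open>f\<close>, below the batch.\<close>

primrec end_prob :: "nat \<Rightarrow> nat \<Rightarrow> nat \<times> (nat \<Rightarrow> real) \<Rightarrow> ennreal" where
  "end_prob x 0 = (\<lambda>(h, f). if h = 0 then 1 else 0)"
| "end_prob x (Suc m) = (\<lambda>(h, f). if h = 0 then 1 else if x < h then 0 else
     arrival_prob (f 0) * (\<integral>\<^sup>+b. \<integral>\<^sup>+d. end_prob x m (h + b, comb_seq b d f) \<partial>DS \<partial>measure_pmf \<beta>)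
     + service_prob (f 0) * end_prob x m (h - 1, \<lambda>i. f (Suc i)))"

lemma measurable_end_prob [measurable]: "end_prob x m \<in> borel_measurable (count_space UNIV \<Otimes>\<^sub>M seqB)"
proof (induction m)
  case 0
  show ?case unfolding end_prob.simps by measurable
next
  case (Suc m)
  note [measurable] = Suc
  show ?case unfolding end_prob.simps by measurable
qed

text \<open>Condition on the first event. An arrival brings a fresh gap; after a completion the rest
  of the gap is again exponential by memorylessness, for which the requirements must be
  nonnegative.\<close>

lemma prob_ended:
  assumes "\<forall>i. 0 \<le> f i"
  shows "(\<integral>\<^sup>+r. \<integral>\<^sup>+w. (if ended x m (h, f, r, w) then 1 else 0) \<partial>IN \<partial>E) = end_prob x m (h, f)"
  using assms
proof (induction m arbitrary: h f)
  case 0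
  show ?case by (simp add: ended_0)
next
  case (Suc m)
  consider "h = 0" | "x < h" | "0 < h" "h \<le> x" by linarith
  then show ?case
  proof cases
    case 1
    then show ?thesis by simp
  next
    case 2
    then show ?thesis by (simp add: ended_Suc)
  next
    case 3
    \<comment> \<open>\<open>A\<close> is the value after an arrival, whatever \<open>r\<close> was;
      \<open>C u\<close> is the value after a completion with residual gap \<open>u\<close>.\<close>
    define A where "A = (\<integral>\<^sup>+w. (if ended x m (h + fst (snd (w 0)),
      comb_seq (fst (snd (w 0))) (snd (snd (w 0))) f, fst (w 0), \<lambda>i. w (Suc i)) then 1 else 0 :: ennreal) \<partial>IN)"
    define C where "C u = (\<integral>\<^sup>+w. (if ended x m (h - 1, \<lambda>i. f (Suc i), u, w) then 1 else 0 :: ennreal) \<partial>IN)" for u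
    have [measurable]: "C \<in> borel_measurable borel"
      unfolding C_def by measurable
    have f0: "0 \<le> f 0" using Suc.prems by simp
    have "(\<integral>\<^sup>+r. \<integral>\<^sup>+w. (if ended x (Suc m) (h, f, r, w) then 1 else 0) \<partial>IN \<partial>E) =
        (\<integral>\<^sup>+r. A * (if r < f 0 then 1 else 0) + (if r < f 0 then 0 else C (r - f 0)) \<partial>E)"
      using 3 by (intro nn_integral_cong) (simp add: ended_Suc bstep_push bstep_pop A_def C_def)
    also have "\<dots> = (\<integral>\<^sup>+r. A * (if r < f 0 then 1 else 0) \<partial>E) + (\<integral>\<^sup>+r. (if r < f 0 then 0 else C (r - f 0)) \<partial>E)"
      by (rule nn_integral_add) measurable
    also have "(\<integral>\<^sup>+r. A * (if r < f 0 then 1 else 0) \<partial>E) = arrival_prob (f 0) * A"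
      unfolding arrival_prob_def by (subst nn_integral_cmult) (simp_all add: mult.commute)
    also have "(\<integral>\<^sup>+r. (if r < f 0 then 0 else C (r - f 0)) \<partial>E) = service_prob (f 0) * (\<integral>\<^sup>+r. C r \<partial>E)"
      by (rule memoryless[OF f0]) measurable
    also have "(\<integral>\<^sup>+r. C r \<partial>E) = end_prob x m (h - 1, \<lambda>i. f (Suc i))"
      unfolding C_def by (rule Suc.IH) (use Suc.prems in simp)
    also have "A = (\<integral>\<^sup>+y. \<integral>\<^sup>+w. (if ended x m (h + fst (snd y), comb_seq (fst (snd y)) (snd (snd y)) f, fst y, w)
        then 1 else 0) \<partial>IN \<partial>X)"
      unfolding A_def by (subst nn_integral_IN_split) simp_all
    also have "\<dots> = (\<integral>\<^sup>+b. \<integral>\<^sup>+d. \<integral>\<^sup>+t. \<integral>\<^sup>+w. (if ended x m (h + b, comb_seq b d f, t, w) then 1 else 0)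
        \<partial>IN \<partial>E \<partial>DS \<partial>measure_pmf \<beta>)"
      by (subst nn_integral_X_split) simp_all
    also have "\<dots> = (\<integral>\<^sup>+b. \<integral>\<^sup>+d. end_prob x m (h + b, comb_seq b d f) \<partial>DS \<partial>measure_pmf \<beta>)"
    \<comment> \<open>The induction hypothesis needs nonnegative requirements, which the new batch
      has only almost surely.\<close>
    proof (rule nn_integral_cong, rule nn_integral_cong_AE)
      fix b
      show "AE d in DS. (\<integral>\<^sup>+t. \<integral>\<^sup>+w. (if ended x m (h + b, comb_seq b d f, t, w) then 1 else 0) \<partial>IN \<partial>E) =
          end_prob x m (h + b, comb_seq b d f)"
        using AE_DS_nonneg
      proof eventually_elim
        case (elim d)
        show ?case by (rule Suc.IH) (use elim Suc.prems in \<open>simp add: comb_seq_def\<close>)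
      qed
    qed
    finally show ?thesis using 3 by simp
  qed
qed

lemma end_prob_empty [simp]: "end_prob x m (0, f) = 1"
  by (cases m) simp_all

lemma end_prob_exceed: "x < h \<Longrightarrow> end_prob x m (h, f) = 0"
  by (cases m) auto

lemma end_prob_Suc: "0 < h \<Longrightarrow> h \<le> x \<Longrightarrow> end_prob x (Suc m) (h, f) =
    arrival_prob (f 0) * (\<integral>\<^sup>+b. \<integral>\<^sup>+d. end_prob x m (h + b, comb_seq b d f) \<partial>DS \<partial>measure_pmf \<beta>)
     + service_prob (f 0) * end_prob x m (h - 1, \<lambda>i. f (Suc i))"
  by simp

lemma end_prob_Suc_mono: "end_prob x m (h, f) \<le> end_prob x (Suc m) (h, f)"
proof (induction m arbitrary: h f)
  case 0
  show ?case by auto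
next
  case (Suc m)
  consider "h = 0" | "x < h" | "0 < h" "h \<le> x" by linarith
  then show ?case
  proof cases
    case 3
    show ?thesis unfolding end_prob_Suc[OF 3]
      by (intro add_mono mult_left_mono nn_integral_mono Suc) simp_all
  qed (simp_all add: end_prob_exceed del: end_prob.simps)
qed

lemma incseq_end_prob: "incseq (\<lambda>m. end_prob x m hf)"
  by (rule incseq_SucI) (metis end_prob_Suc_mono surj_pair)

text \<open>The exact product rule fails for a fixed number of steps, since the steps spent on the two parts
  of the stack add up; the two inequalities below become an equality in the limit.\<close>

lemma end_prob_append_le:
  "end_prob (x + k) m (h + k, comb_seq h d f) \<le> end_prob x m (h, d) * end_prob (x + k) m (k, f)"
proof (induction m arbitrary: h d)
  case 0
  show ?case by simp
next
  case (Suc m)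
  consider "h = 0" | "x < h" | "0 < h" "h \<le> x" by linarith
  then show ?case
  proof cases
    case 1
    then show ?thesis by (simp add: comb_seq_0 del: end_prob.simps)
  next
    case 2
    then show ?thesis by (simp add: end_prob_exceed del: end_prob.simps)
  next
    case 3
    let ?g = "end_prob (x + k) m (k, f)"
    have eq: "h + k - 1 = (h - 1) + k" using 3 by simp
    have d0: "comb_seq h d f 0 = d 0" using 3 by (simp add: comb_seq_def)
    have "(\<integral>\<^sup>+b. \<integral>\<^sup>+d'. end_prob (x + k) m (h + k + b, comb_seq b d' (comb_seq h d f)) \<partial>DS \<partial>measure_pmf \<beta>)
        \<le> (\<integral>\<^sup>+b. \<integral>\<^sup>+d'. end_prob x m (h + b, comb_seq b d' d) * ?g \<partial>DS \<partial>measure_pmf \<beta>)"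
    proof (intro nn_integral_mono)
      fix b d'
      \<comment> \<open>The batch joins the upper part, which becomes a stack of height
        \<open>b + h\<close>; this is why the induction leaves \<open>h\<close> and \<open>d\<close>
        arbitrary.\<close>
      show "end_prob (x + k) m (h + k + b, comb_seq b d' (comb_seq h d f)) \<le> end_prob x m (h + b, comb_seq b d' d) * ?g"
        using Suc[of "b + h" "comb_seq b d' d"] by (simp add: comb_seq_assoc ac_simps)
    qed
    also have "\<dots> = (\<integral>\<^sup>+b. \<integral>\<^sup>+d'. end_prob x m (h + b, comb_seq b d' d) \<partial>DS \<partial>measure_pmf \<beta>) * ?g"
      by (simp add: nn_integral_multc)
    finally have 1: "(\<integral>\<^sup>+b. \<integral>\<^sup>+d'. end_prob (x + k) m (h + k + b, comb_seq b d' (comb_seq h d f)) \<partial>DS \<partial>measure_pmf \<beta>)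
        \<le> (\<integral>\<^sup>+b. \<integral>\<^sup>+d'. end_prob x m (h + b, comb_seq b d' d) \<partial>DS \<partial>measure_pmf \<beta>) * ?g" (is "?I \<le> ?J * ?g") .
    have 2: "end_prob (x + k) m (h + k - 1, \<lambda>i. comb_seq h d f (Suc i)) \<le> end_prob x m (h - 1, \<lambda>i. d (Suc i)) * ?g"
      unfolding eq comb_seq_tail[OF 3(1)] by (rule Suc)
    have "end_prob (x + k) (Suc m) (h + k, comb_seq h d f)
        \<le> arrival_prob (d 0) * (?J * ?g) + service_prob (d 0) * (end_prob x m (h - 1, \<lambda>i. d (Suc i)) * ?g)"
      using 3 by (subst end_prob_Suc) (auto simp: d0 simp del: end_prob.simps One_nat_def intro!: add_mono mult_left_mono 1 2)
    also have "\<dots> = end_prob x (Suc m) (h, d) * ?g"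
      using 3 by (subst end_prob_Suc) (auto simp: distrib_right mult.assoc)
    \<comment> \<open>The lower part was allotted only \<open>m\<close> steps; monotonicity grants
      it one more.\<close>
    also have "\<dots> \<le> end_prob x (Suc m) (h, d) * end_prob (x + k) (Suc m) (k, f)"
      by (rule mult_left_mono[OF end_prob_Suc_mono]) simp
    finally show ?thesis .
  qed
qed

lemma end_prob_append_ge:
  "end_prob x m (h, d) * end_prob (x + k) n (k, f) \<le> end_prob (x + k) (m + n) (h + k, comb_seq h d f)"
proof (induction m arbitrary: h d)
  case 0
  show ?case by (simp add: comb_seq_0)
next
  case (Suc m)
  consider "h = 0" | "x < h" | "0 < h" "h \<le> x" by linarith
  then show ?case
  proof cases
    case 1
    \<comment> \<open>The upper part is empty, so its \<open>Suc m\<close> steps are surplus for the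
      lower one.\<close>
    then show ?thesis
      using incseqD[OF incseq_end_prob, of n "Suc m + n" "x + k" "(k, f)"] by (simp add: comb_seq_0 del: end_prob.simps)
  next
    case 2
    then show ?thesis by (simp add: end_prob_exceed del: end_prob.simps)
  next
    case 3
    let ?g = "end_prob (x + k) n (k, f)"
    have eq: "h + k - 1 = (h - 1) + k" using 3 by simp
    have d0: "comb_seq h d f 0 = d 0" using 3 by (simp add: comb_seq_def)
    have "(\<integral>\<^sup>+b. \<integral>\<^sup>+d'. end_prob x m (h + b, comb_seq b d' d) \<partial>DS \<partial>measure_pmf \<beta>) * ?g =
        (\<integral>\<^sup>+b. \<integral>\<^sup>+d'. end_prob x m (h + b, comb_seq b d' d) * ?g \<partial>DS \<partial>measure_pmf \<beta>)" (is "?J * ?g = _")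
      by (simp add: nn_integral_multc)
    also have "\<dots> \<le> (\<integral>\<^sup>+b. \<integral>\<^sup>+d'. end_prob (x + k) (m + n) (h + k + b, comb_seq b d' (comb_seq h d f)) \<partial>DS \<partial>measure_pmf \<beta>)"
      (is "_ \<le> ?I")
    proof (intro nn_integral_mono)
      fix b d'
      show "end_prob x m (h + b, comb_seq b d' d) * ?g \<le> end_prob (x + k) (m + n) (h + k + b, comb_seq b d' (comb_seq h d f))"
        using Suc[of "b + h" "comb_seq b d' d"] by (simp add: comb_seq_assoc ac_simps)
    qed
    finally have 1: "?J * ?g \<le> ?I" .
    have 2: "end_prob x m (h - 1, \<lambda>i. d (Suc i)) * ?g \<le> end_prob (x + k) (m + n) (h + k - 1, \<lambda>i. comb_seq h d f (Suc i))"
      unfolding eq comb_seq_tail[OF 3(1)] by (rule Suc)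
    have "end_prob x (Suc m) (h, d) * ?g = arrival_prob (d 0) * (?J * ?g) + service_prob (d 0) * (end_prob x m (h - 1, \<lambda>i. d (Suc i)) * ?g)"
      using 3 by (subst end_prob_Suc) (auto simp: distrib_right mult.assoc)
    also have "\<dots> \<le> end_prob (x + k) (Suc (m + n)) (h + k, comb_seq h d f)"
      using 3 by (subst end_prob_Suc) (auto simp: d0 simp del: end_prob.simps One_nat_def intro!: add_mono mult_left_mono 1 2)
    finally show ?thesis by simp
  qed
qed

text \<open>The probability of ever emptying the stack within height \<open>x\<close>. That it is
  the distribution function of \<open>peak\<close> is established only in
  \<open>prob_peak_le\<close>.\<close>

definition peak_cdf :: "nat \<Rightarrow> nat \<times> (nat \<Rightarrow> real) \<Rightarrow> ennreal" where
  "peak_cdf x hf = (SUP m. end_prob x m hf)"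

lemma measurable_peak_cdf [measurable]: "peak_cdf x \<in> borel_measurable (count_space UNIV \<Otimes>\<^sub>M seqB)"
  unfolding peak_cdf_def by measurable

lemma peak_cdf_empty [simp]: "peak_cdf x (0, f) = 1"
  by (simp add: peak_cdf_def)

lemma peak_cdf_exceed: "x < h \<Longrightarrow> peak_cdf x (h, f) = 0"
  by (simp add: peak_cdf_def end_prob_exceed)

text \<open>Until the upper part is gone, the \<open>k\<close> customers below merely raise the
  height by \<open>k\<close>; then the lower part starts from scratch with the full bound. In the
  limit the step counts no longer matter.\<close>

lemma peak_cdf_append: "peak_cdf (x + k) (h + k, comb_seq h d f) = peak_cdf x (h, d) * peak_cdf (x + k) (k, f)"
proof (rule antisym)
  have "end_prob (x + k) m (h + k, comb_seq h d f) \<le> peak_cdf x (h, d) * peak_cdf (x + k) (k, f)" for m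
    using end_prob_append_le[of x k m h d f] unfolding peak_cdf_def
    by (rule order_trans) (intro mult_mono SUP_upper; simp)
  then show "peak_cdf (x + k) (h + k, comb_seq h d f) \<le> peak_cdf x (h, d) * peak_cdf (x + k) (k, f)"
    unfolding peak_cdf_def[of _ "(h + k, _)"] by (rule SUP_least)
next
  have "end_prob x m (h, d) * end_prob (x + k) n (k, f) \<le> peak_cdf (x + k) (h + k, comb_seq h d f)" for m n
    using end_prob_append_ge[of x m h d k n f] unfolding peak_cdf_def by (rule order_trans) (rule SUP_upper, simp)
  then show "peak_cdf x (h, d) * peak_cdf (x + k) (k, f) \<le> peak_cdf (x + k) (h + k, comb_seq h d f)"
    unfolding peak_cdf_def[of _ "(h, _)"] peak_cdf_def[of _ "(k, _)"]
    by (simp only: SUP_mult_right_ennreal SUP_mult_left_ennreal SUP_le_iff) simp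
qed

text \<open>Monotone convergence applied to both terms of \<open>end_prob_Suc\<close>.\<close>

lemma peak_cdf_rec:
  assumes "0 < h" "h \<le> x"
  shows "peak_cdf x (h, f) = arrival_prob (f 0) * (\<integral>\<^sup>+b. \<integral>\<^sup>+d. peak_cdf x (h + b, comb_seq b d f) \<partial>DS \<partial>measure_pmf \<beta>)
     + service_prob (f 0) * peak_cdf x (h - 1, \<lambda>i. f (Suc i))"
proof -
  let ?J = "\<lambda>m. \<integral>\<^sup>+b. \<integral>\<^sup>+d. end_prob x m (h + b, comb_seq b d f) \<partial>DS \<partial>measure_pmf \<beta>"
  have inc: "end_prob x m hf \<le> end_prob x n hf" if "m \<le> n" for m n hf
    using that by (rule incseqD[OF incseq_end_prob])
  have incJ: "incseq ?J"
    by (intro incseq_def[THEN iffD2] allI impI nn_integral_mono inc)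
  have "peak_cdf x (h, f) = (SUP m. end_prob x (Suc m) (h, f))"
    unfolding peak_cdf_def
  proof (rule SUP_eq)
    fix i
    show "\<exists>j\<in>UNIV. end_prob x i (h, f) \<le> end_prob x (Suc j) (h, f)" by (intro bexI[of _ i] inc) simp_all
    show "\<exists>j\<in>UNIV. end_prob x (Suc i) (h, f) \<le> end_prob x j (h, f)" by (intro bexI[of _ "Suc i"] order_refl UNIV_I)
  qed
  also have "\<dots> = (SUP m. arrival_prob (f 0) * ?J m + service_prob (f 0) * end_prob x m (h - 1, \<lambda>i. f (Suc i)))"
    unfolding end_prob_Suc[OF assms] ..
  also have "\<dots> = (SUP m. arrival_prob (f 0) * ?J m) + (SUP m. service_prob (f 0) * end_prob x m (h - 1, \<lambda>i. f (Suc i)))"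
    using incJ inc by (intro ennreal_SUP_add) (auto simp: incseq_def intro!: mult_left_mono)
  also have "\<dots> = arrival_prob (f 0) * (SUP m. ?J m) + service_prob (f 0) * peak_cdf x (h - 1, \<lambda>i. f (Suc i))"
    by (simp add: SUP_mult_left_ennreal peak_cdf_def)
  also have "(SUP m. ?J m) = (\<integral>\<^sup>+b. (SUP m. \<integral>\<^sup>+d. end_prob x m (h + b, comb_seq b d f) \<partial>DS) \<partial>measure_pmf \<beta>)"
    by (rule nn_integral_monotone_convergence_SUP[symmetric])
       (auto simp: incseq_def le_fun_def intro!: nn_integral_mono inc)
  also have "\<dots> = (\<integral>\<^sup>+b. \<integral>\<^sup>+d. peak_cdf x (h + b, comb_seq b d f) \<partial>DS \<partial>measure_pmf \<beta>)"
    unfolding peak_cdf_def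
    by (intro nn_integral_cong nn_integral_monotone_convergence_SUP[symmetric])
       (auto simp: incseq_def le_fun_def intro!: inc)
  finally show ?thesis .
qed

section \<open>Bounded busy periods end almost surely\<close>

text \<open>If no run occurs, then the first \<open>N\<close> entries are not all in
  \<open>A\<close> and the sequence after them has no run either. By independence the probability p
  of no run satisfies p \<le> (1 - q) p, where q > 0 is the probability that the first
  \<open>N\<close> entries lie in \<open>A\<close>.\<close>

lemma AE_run:
  assumes A [measurable]: "A \<in> sets X" and pos: "0 < emeasure X A"
  shows "AE w in IN. \<exists>n. \<forall>i<N. w (n + i) \<in> A"
proof -
  define NR where "NR = {w. \<not> (\<exists>n. \<forall>i<N. w (n + i) \<in> A)}"
  define R where "R = {w. \<forall>i<N. w i \<in> A}"
  have [measurable]: "NR \<in> sets IN" "R \<in> sets IN"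
  proof -
    have "{w \<in> space IN. \<not> (\<exists>n. \<forall>i<N. w (n + i) \<in> A)} \<in> sets IN" by measurable
    then show "NR \<in> sets IN" by (simp add: NR_def)
    have "{w \<in> space IN. \<forall>i<N. w i \<in> A} \<in> sets IN" by measurable
    then show "R \<in> sets IN" by (simp add: R_def)
  qed
  have "emeasure IN R = emeasure IN {w \<in> space IN. \<forall>i\<in>{..<N}. w i \<in> A}"
    by (simp add: R_def Ball_def)
  also have "\<dots> = (\<Prod>i\<in>{..<N}. emeasure X A)"
    by (rule W.emeasure_PiM_Collect) (rule subset_UNIV finite_lessThan A)+
  finally have "emeasure IN R = emeasure X A ^ N" by simp
  then have "emeasure IN R \<noteq> 0" using pos by simp
  then have R: "0 < measure IN R"
    by (simp add: W.emeasure_eq_measure zero_less_measure_iff)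
  have "emeasure IN NR = emeasure (distr (IN \<Otimes>\<^sub>M IN) IN (\<lambda>(u, v). comb_seq N u v)) NR"
    by (simp add: W.PiM_comb_seq)
  also have "\<dots> = emeasure (IN \<Otimes>\<^sub>M IN) ((\<lambda>(u, v). comb_seq N u v) -` NR \<inter> space (IN \<Otimes>\<^sub>M IN))"
    by (rule emeasure_distr) measurable
  also have "\<dots> \<le> emeasure (IN \<Otimes>\<^sub>M IN) ((- R) \<times> NR)"
  proof (rule emeasure_mono)
    have 1: "comb_seq N u v \<notin> NR" if "u \<in> R" for u v
    proof -
      have "\<forall>i<N. comb_seq N u v (0 + i) \<in> A" using that by (simp add: comb_seq_def R_def)
      then have "\<exists>n. \<forall>i<N. comb_seq N u v (n + i) \<in> A" by (rule exI)
      then show ?thesis by (simp add: NR_def)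
    qed
    have 2: "comb_seq N u v \<notin> NR" if "v \<notin> NR" for u v
    proof -
      have "\<exists>n. \<forall>i<N. v (n + i) \<in> A" using that by (simp add: NR_def)
      then obtain n where "\<forall>i<N. v (n + i) \<in> A" by (rule exE)
      then have "\<forall>i<N. comb_seq N u v ((N + n) + i) \<in> A" by (simp add: comb_seq_def)
      then have "\<exists>n. \<forall>i<N. comb_seq N u v (n + i) \<in> A" by (rule exI)
      then show ?thesis by (simp add: NR_def)
    qed
    show "(\<lambda>(u, v). comb_seq N u v) -` NR \<inter> space (IN \<Otimes>\<^sub>M IN) \<subseteq> (- R) \<times> NR"
      using 1 2 by auto
    have "- R \<in> sets IN" using sets.compl_sets[of R IN] by (simp add: Compl_eq_Diff_UNIV)
    then show "(- R) \<times> NR \<in> sets (IN \<Otimes>\<^sub>M IN)" by measurable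
  qed
  also have "\<dots> = emeasure IN (- R) * emeasure IN NR"
    using sets.compl_sets[of R IN] by (intro W.emeasure_pair_measure_Times) (simp_all add: Compl_eq_Diff_UNIV)
  also have "emeasure IN (- R) = ennreal (1 - measure IN R)"
    using W.prob_compl[of R] by (simp add: W.emeasure_eq_measure Compl_eq_Diff_UNIV)
  finally have "measure IN NR \<le> (1 - measure IN R) * measure IN NR"
    by (simp add: W.emeasure_eq_measure ennreal_mult[symmetric])
  then have "measure IN R * measure IN NR \<le> 0" by (simp add: algebra_simps)
  then have "measure IN NR = 0"
    using R by (simp add: mult_le_0_iff) (meson measure_nonneg order_antisym)
  then have "NR \<in> null_sets IN" by (simp add: null_sets_def W.emeasure_eq_measure)
  then show ?thesis by (rule AE_I') (auto simp: NR_def)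
qed

lemma emeasure_E_less: "emeasure E {..<a} = arrival_prob a"
proof -
  have "arrival_prob a = (\<integral>\<^sup>+t. indicator {..<a} t \<partial>E)"
    unfolding arrival_prob_def by (rule nn_integral_cong) (simp add: indicator_def)
  then show ?thesis by simp
qed

lemma emeasure_E_ge: "emeasure E {a..} = service_prob a"
proof -
  have "service_prob a = (\<integral>\<^sup>+t. indicator {a..} t \<partial>E)"
    unfolding service_prob_def by (rule nn_integral_cong) (simp add: indicator_def)
  then show ?thesis by simp
qed

text \<open>The set is a rectangle in the three independent components; nonempty batches contribute
  the factor 1.\<close>

lemma emeasure_preempting_pos:
  assumes "emeasure Sd {1<..} \<noteq> 0"
  shows "Collect preempting \<in> sets X" "0 < emeasure X (Collect preempting)"
proof -
  have "{y \<in> space X. preempting y} \<in> sets X" unfolding preempting_def by measurable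
  then show "Collect preempting \<in> sets X" by simp
  have eq: "Collect preempting = {..<1} \<times> ({1..} \<times> {d. 1 < d 0})"
    by (auto simp: preempting_def)
  have m: "{d. 1 < d 0} \<in> sets DS"
  proof -
    have "{d \<in> space DS. 1 < d 0} \<in> sets DS" by measurable
    then show ?thesis by simp
  qed
  have "emeasure DS {d. 1 < d 0} = emeasure DS {d \<in> space DS. \<forall>i\<in>{0}. d i \<in> {1<..}}"
    by simp
  also have "\<dots> = (\<Prod>i\<in>{0::nat}. emeasure Sd {1<..})"
    by (rule D.emeasure_PiM_Collect) (auto simp: sets_Sd)
  finally have D: "emeasure DS {d. 1 < d 0} = emeasure Sd {1<..}" by simp
  have B: "emeasure (measure_pmf \<beta>) {1..} = 1"
    using batch_pos by (simp add: measure_pmf.emeasure_eq_1_AE AE_measure_pmf_iff subset_eq)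
  have "emeasure X (Collect preempting) = arrival_prob 1 * (1 * emeasure Sd {1<..})"
    unfolding eq using m
    by (simp add: BD.emeasure_pair_measure_Times D.emeasure_pair_measure_Times D B emeasure_E_less del: One_nat_def)
  then show "0 < emeasure X (Collect preempting)"
    using assms arrival_prob_pos[of 1] by (simp add: ennreal_zero_less_mult_iff zero_less_iff_neq_zero)
qed

text \<open>If services can exceed 1, \<open>AE_run\<close> supplies a preempting run of length
  \<open>Suc x\<close>; otherwise it supplies a gap too long for the bounded work.\<close>

lemma AE_bounded_ends:
  "AE w in IN. peak (h, f, r, w) \<le> enat x \<longrightarrow> (\<exists>m. height (h, f, r, w) m = 0)"
proof (cases "emeasure Sd {1<..} = 0")
  case False
  from AE_run[OF emeasure_preempting_pos[OF False], of "Suc x"]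
  show ?thesis
  proof eventually_elim
    case (elim w)
    then obtain n where "\<forall>i<Suc x. preempting (w (n + i))"
      unfolding mem_Collect_eq by blast
    then show ?case using preempting_runs_end_or_exceed[of h f r w x n] unfolding peak_le_iff by metis
  qed
next
  case True
  \<comment> \<open>Dominates both the future requirements, almost surely at most 1, and the
    arbitrary initial ones.\<close>
  define c where "c = 1 + (\<Sum>i<h. \<bar>f i\<bar>)"
  have c: "1 \<le> c" "\<forall>i<h. f i \<le> c"
  proof -
    show "1 \<le> c" by (simp add: c_def sum_nonneg)
    have "\<bar>f i\<bar> \<le> (\<Sum>i<h. \<bar>f i\<bar>)" if "i < h" for i
      using that by (intro member_le_sum) auto
    then show "\<forall>i<h. f i \<le> c" unfolding c_def by force
  qed
  have Sd1: "AE x in Sd. x \<le> 1"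
    by (rule AE_I'[of "{1<..}"]) (use True in \<open>auto simp: null_sets_def sets_Sd\<close>)
  have "AE d in DS. d i \<le> 1" for i
    using AE_PiM_component[of UNIV "\<lambda>_. Sd" i "\<lambda>x. x \<le> 1"] prob_space_Sd Sd1 by simp
  then have AE_DS: "AE d in DS. \<forall>i. d i \<le> 1" by (simp add: AE_all_countable)
  define Q :: "(nat \<Rightarrow> real) \<Rightarrow> bool" where "Q d \<longleftrightarrow> (\<forall>i. d i \<le> 1)" for d
  have [measurable]: "Measurable.pred seqB Q" unfolding Q_def by measurable
  have "AE p in measure_pmf \<beta> \<Otimes>\<^sub>M DS. Q (snd p)"
    by (rule BD.AE_pair_measure) (measurable, use AE_DS in \<open>simp add: Q_def\<close>)
  then have "AE y in X. Q (snd (snd y))"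
    by (intro X.AE_pair_measure[rotated]) (simp, measurable)
  then have "AE w in IN. Q (snd (snd (w n)))" for n
    using AE_PiM_component[of UNIV "\<lambda>_. X" n "\<lambda>y. Q (snd (snd y))"] X.prob_space_axioms by simp
  then have W: "AE w in IN. \<forall>n i. snd (snd (w n)) i \<le> 1" by (simp add: AE_all_countable Q_def)
  \<comment> \<open>Entries whose gap serves \<open>x\<close> customers of requirement
    \<open>c\<close>; a run of length 1 in this set is enough.\<close>
  let ?A = "{real x * c..} \<times> (UNIV :: (nat \<times> (nat \<Rightarrow> real)) set)"
  have U: "UNIV \<in> sets (measure_pmf \<beta> \<Otimes>\<^sub>M DS)" "emeasure (measure_pmf \<beta> \<Otimes>\<^sub>M DS) UNIV = 1"
    using sets.top[of "measure_pmf \<beta> \<Otimes>\<^sub>M DS"] BD.emeasure_space_1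
    unfolding space_pair_measure space_DS space_measure_pmf UNIV_Times_UNIV by blast+
  have "?A \<in> sets X" by (rule pair_measureI[OF _ U(1)]) simp
  moreover have "emeasure X ?A = service_prob (real x * c)"
    using BD.emeasure_pair_measure_Times[of "{real x * c..}" E UNIV] U by (simp add: emeasure_E_ge)
  moreover have "0 < service_prob (real x * c)" using c(1) by (subst service_prob_eq) auto
  ultimately have "AE w in IN. \<exists>n. \<forall>i<1. w (n + i) \<in> ?A" by (intro AE_run) simp_all
  with W show ?thesis
  proof eventually_elim
    case (elim w)
    then obtain n where n: "real x * c \<le> fst (w n)" by (auto simp: mem_Times_iff)
    have "snd (snd (w n)) i \<le> c" for n i
      using elim(1)[rule_format, of n i] c(1) by linarith
    then have "work_le c (h, f, r, w)" using c(2) by (simp add: work_le_def)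
    note gap = bounded_work_no_long_gap[OF _ this, of x n]
    show ?case
    proof (intro impI, rule ccontr)
      assume "peak (h, f, r, w) \<le> enat x" "\<nexists>m. height (h, f, r, w) m = 0"
      then have "fst (w n) < real x * c" using c(1) by (intro gap) (simp_all add: peak_le_iff)
      with n show False by simp
    qed
  qed
qed

text \<open>Up to a null set a bounded peak is the increasing union of the events
  \<open>ended x m\<close>, so monotone convergence turns \<open>prob_ended\<close> into the
  limit.\<close>

lemma prob_peak_le:
  assumes "\<forall>i. 0 \<le> f i"
  shows "(\<integral>\<^sup>+r. \<integral>\<^sup>+w. (if peak (h, f, r, w) \<le> enat x then 1 else 0) \<partial>IN \<partial>E) = peak_cdf x (h, f)"
proof -
  let ?e = "\<lambda>m r w. if ended x m (h, f, r, w) then 1 else 0 :: ennreal"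
  have SUP: "(if \<exists>m. ended x m (h, f, r, w) then 1 else 0) = (SUP m. ?e m r w)" for r w
  proof (cases "\<exists>m. ended x m (h, f, r, w)")
    case True
    then obtain m where "ended x m (h, f, r, w)" by blast
    then have "1 \<le> (SUP m. ?e m r w)" by (intro SUP_upper2[of m]) simp_all
    moreover have "(SUP m. ?e m r w) \<le> 1" by (intro SUP_least) simp
    ultimately show ?thesis using True by simp
  qed simp
  have "(\<integral>\<^sup>+r. \<integral>\<^sup>+w. (if peak (h, f, r, w) \<le> enat x then 1 else 0) \<partial>IN \<partial>E) =
      (\<integral>\<^sup>+r. \<integral>\<^sup>+w. (SUP m. ?e m r w) \<partial>IN \<partial>E)"
  proof (rule nn_integral_cong, rule nn_integral_cong_AE)
    fix r
    show "AE w in IN. (if peak (h, f, r, w) \<le> enat x then 1 else 0) = (SUP m. ?e m r w)"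
      using AE_bounded_ends[of h f r x]
      unfolding SUP[symmetric] by eventually_elim (auto simp: ex_ended_iff)
  qed
  also have "\<dots> = (\<integral>\<^sup>+r. (SUP m. \<integral>\<^sup>+w. ?e m r w \<partial>IN) \<partial>E)"
    by (intro nn_integral_cong nn_integral_monotone_convergence_SUP)
       (auto simp: incseq_def le_fun_def dest: ended_mono)
  also have "\<dots> = (SUP m. \<integral>\<^sup>+r. \<integral>\<^sup>+w. ?e m r w \<partial>IN \<partial>E)"
    by (intro nn_integral_monotone_convergence_SUP)
       (auto simp: incseq_def le_fun_def intro!: nn_integral_mono dest: ended_mono)
  also have "\<dots> = peak_cdf x (h, f)"
    unfolding prob_ended[OF assms] peak_cdf_def ..
  finally show ?thesis .
qed

end

section \<open>Distribution functions of the maxima\<close>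

text \<open>Finite point masses are differences of distribution functions; the mass at infinity is
  what is missing from 1.\<close>

lemma prob_enat_eqI:
  fixes M N :: "enat measure"
  assumes "prob_space M" "prob_space N" and sets: "sets M = UNIV" "sets N = UNIV"
    and le: "\<And>x. emeasure M {..enat x} = emeasure N {..enat x}"
  shows "M = N"
proof (rule measure_eqI_countable[of _ UNIV])
  interpret M: prob_space M by fact
  interpret N: prob_space N by fact
  have sp: "space M = UNIV" "space N = UNIV"
    using sets.space_closed[of M] sets.space_closed[of N] sets by auto
  fix a :: enat
  show "emeasure M {a} = emeasure N {a}"
  proof (cases a)
    case (enat n)
    show ?thesis
    proof (cases n)
      case 0
      then have "{a} = {..enat 0}" using enat by (auto simp: zero_enat_def[symmetric])
      then show ?thesis using le[of 0] by simp
    next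
      case (Suc m)
      then have a: "{a} = {..enat (Suc m)} - {..enat m}"
        using enat by (auto simp: less_Suc_eq_le) (metis Suc_le_eq antisym enat_ile enat_ord_simps(1) linorder_not_le)
      have "{..enat m} \<subseteq> {..enat (Suc m)}" by (auto intro: order_trans)
      then show ?thesis
        unfolding a using le sets by (simp add: emeasure_Diff)
    qed
  next
    case infinity
    have U: "(\<Union>n. {..enat n}) = UNIV - {\<infinity>}"
    proof -
      have "\<exists>n. y \<le> enat n" if "y \<noteq> \<infinity>" for y using that by (cases y) auto
      then show ?thesis by (auto simp del: not_infinity_eq)
    qed
    have "emeasure M (\<Union>n. {..enat n}) = emeasure N (\<Union>n. {..enat n})"
      using le sets by (subst (1 2) SUP_emeasure_incseq[symmetric]) (auto simp: incseq_def intro: order_trans)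
    moreover have "emeasure M {\<infinity>} = 1 - emeasure M (UNIV - {\<infinity>})"
      using M.emeasure_space_1 emeasure_compl[of "UNIV - {\<infinity>}" M] sets sp by (simp add: Diff_Diff_Int)
    moreover have "emeasure N {\<infinity>} = 1 - emeasure N (UNIV - {\<infinity>})"
      using N.emeasure_space_1 emeasure_compl[of "UNIV - {\<infinity>}" N] sets sp by (simp add: Diff_Diff_Int)
    ultimately show ?thesis by (simp add: infinity U)
  qed
qed (simp_all add: sets)

text \<open>All factors are countable and discrete, hence so is the product.\<close>

lemma measurable_pair4_count:
  fixes I :: "bool measure" and M M' M'' :: "enat measure"
  assumes "sets I = UNIV" "sets M = UNIV" "sets M' = UNIV" "sets M'' = UNIV"
  shows "\<phi> \<in> (I \<Otimes>\<^sub>M (M \<Otimes>\<^sub>M (M' \<Otimes>\<^sub>M M''))) \<rightarrow>\<^sub>M count_space UNIV"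
proof -
  have "sets (I \<Otimes>\<^sub>M (M \<Otimes>\<^sub>M (M' \<Otimes>\<^sub>M M''))) =
      sets (count_space UNIV \<Otimes>\<^sub>M (count_space UNIV \<Otimes>\<^sub>M (count_space UNIV \<Otimes>\<^sub>M count_space UNIV)))"
    by (intro sets_pair_measure_cong) (simp_all add: assms)
  also have "count_space UNIV \<Otimes>\<^sub>M (count_space UNIV \<Otimes>\<^sub>M (count_space UNIV \<Otimes>\<^sub>M count_space UNIV)) =
      (count_space UNIV :: (bool \<times> enat \<times> enat \<times> enat) measure)"
    by (simp add: pair_measure_countable countableI_type)
  finally have "sets (I \<Otimes>\<^sub>M (M \<Otimes>\<^sub>M (M' \<Otimes>\<^sub>M M''))) = sets (count_space UNIV)" .
  note eq = measurable_cong_sets[OF this refl, of "count_space UNIV"]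
  show ?thesis unfolding eq by simp
qed

text \<open>The preimage splits into two disjoint rectangles, one for each value of
  \<open>i\<close>, with the components of the other branch unrestricted. For \<open>k > x\<close>
  it is empty.\<close>

lemma emeasure_mixture_le:
  fixes I :: "bool measure" and M M' M'' :: "enat measure"
  assumes "prob_space I" "prob_space M" "prob_space M'" "prob_space M''"
    and sets: "sets I = UNIV" "sets M = UNIV" "sets M' = UNIV" "sets M'' = UNIV"
  shows "emeasure (distr (I \<Otimes>\<^sub>M (M \<Otimes>\<^sub>M (M' \<Otimes>\<^sub>M M''))) (count_space UNIV)
      (\<lambda>(i, m, m', m''). if i then max (m + enat k) m' else max (enat k) m'')) {..enat x} =
    (if k \<le> x then emeasure I {True} * (emeasure M {..enat (x - k)} * emeasure M' {..enat x})
       + emeasure I {False} * emeasure M'' {..enat x} else 0)"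
    (is "emeasure (distr ?P _ ?\<phi>) _ = _")
proof -
  interpret I: prob_space I by fact
  interpret M: prob_space M by fact
  interpret M': prob_space M' by fact
  interpret M'': prob_space M'' by fact
  interpret A: pair_prob_space M' M'' by standard
  interpret B: pair_prob_space M "M' \<Otimes>\<^sub>M M''" by standard
  interpret C: pair_prob_space I "M \<Otimes>\<^sub>M (M' \<Otimes>\<^sub>M M'')" by standard
  have sp: "space I = UNIV" "space M = UNIV" "space M' = UNIV" "space M'' = UNIV"
    using sets sets.space_closed[of I] sets.space_closed[of M] sets.space_closed[of M'] sets.space_closed[of M'']
    by auto
  have meas: "?\<phi> \<in> ?P \<rightarrow>\<^sub>M count_space UNIV"
    by (rule measurable_pair4_count[OF sets])
  have one: "emeasure M UNIV = 1" "emeasure M' UNIV = 1" "emeasure M'' UNIV = 1"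
    using M.emeasure_space_1 M'.emeasure_space_1 M''.emeasure_space_1 sp by simp_all
  have D: "emeasure (distr ?P (count_space UNIV) ?\<phi>) {..enat x} = emeasure ?P (?\<phi> -` {..enat x})"
    by (subst emeasure_distr[OF meas]) (simp_all add: space_pair_measure sp)
  show ?thesis
  proof (cases "k \<le> x")
    case False
    have "\<not> m + enat k \<le> enat x" for m using False by (cases m) auto
    then have "?\<phi> -` {..enat x} = {}" using False by (auto split: if_splits)
    then show ?thesis using False by (simp add: D)
  next
    case True
    \<comment> \<open>Subtraction on \<open>nat\<close> truncates, so \<open>k\<close> must not
      exceed \<open>x\<close> here.\<close>
    have le: "m + enat k \<le> enat x \<longleftrightarrow> m \<le> enat (x - k)" for m
      using True by (cases m) auto
    have "?\<phi> -` {..enat x} = {True} \<times> ({..enat (x - k)} \<times> ({..enat x} \<times> UNIV))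
        \<union> {False} \<times> (UNIV \<times> (UNIV \<times> {..enat x}))" (is "_ = ?T \<union> ?F")
      using True by (auto simp: le split: if_splits)
    moreover have "emeasure ?P (?T \<union> ?F) = emeasure ?P ?T + emeasure ?P ?F"
      by (rule plus_emeasure[symmetric]) (auto simp: sets intro!: pair_measureI)
    moreover have "emeasure ?P ?T = emeasure I {True} * (emeasure M {..enat (x - k)} * emeasure M' {..enat x})"
      by (subst B.emeasure_pair_measure_Times A.emeasure_pair_measure_Times M''.emeasure_pair_measure_Times,
          (auto simp: sets one intro!: pair_measureI)[2])+ (simp add: one)
    moreover have "emeasure ?P ?F = emeasure I {False} * emeasure M'' {..enat x}"
      by (subst B.emeasure_pair_measure_Times A.emeasure_pair_measure_Times M''.emeasure_pair_measure_Times,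
          (auto simp: sets one intro!: pair_measureI)[2])+ (simp add: one)
    ultimately show ?thesis using True by (simp add: D)
  qed
qed

section \<open>The laws of the model and their recursion\<close>

context mxg1
begin

text \<open>The map \<open>g\<close> alters only the size and the requirements of the first batch,
  so one computation covers the unconditional law and both conditional ones.\<close>

definition start :: "(nat \<times> (nat \<Rightarrow> real) \<Rightarrow> nat \<times> (nat \<Rightarrow> real)) \<Rightarrow> inp \<Rightarrow> busy" where
  "start g w = (fst (g (snd (w 0))), snd (g (snd (w 0))), fst (w 0), \<lambda>i. w (Suc i))"

lemma measurable_start [measurable]:
  assumes [measurable]: "g \<in> count_space UNIV \<Otimes>\<^sub>M seqB \<rightarrow>\<^sub>M count_space UNIV \<Otimes>\<^sub>M seqB"
  shows "start g \<in> IN \<rightarrow>\<^sub>M busyB"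
  unfolding start_def by measurable

text \<open>Since \<open>g\<close> leaves the first gap alone, that gap stays exponential and
  independent of the initial stack, and \<open>prob_peak_le\<close> applies for almost every
  \<open>d\<close>.\<close>

lemma law_peak_le:
  assumes g [measurable]: "g \<in> count_space UNIV \<Otimes>\<^sub>M seqB \<rightarrow>\<^sub>M count_space UNIV \<Otimes>\<^sub>M seqB"
    and nonneg: "\<And>b d. \<forall>i. 0 \<le> d i \<Longrightarrow> \<forall>i. 0 \<le> snd (g (b, d)) i"
  shows "emeasure (distr IN (count_space UNIV) (\<lambda>w. peak (start g w))) {..enat x} =
    (\<integral>\<^sup>+b. \<integral>\<^sup>+d. peak_cdf x (g (b, d)) \<partial>DS \<partial>measure_pmf \<beta>)"
proof -
  have "emeasure (distr IN (count_space UNIV) (\<lambda>w. peak (start g w))) {..enat x} =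
      (\<integral>\<^sup>+y. indicator {..enat x} y \<partial>distr IN (count_space UNIV) (\<lambda>w. peak (start g w)))"
    by (rule nn_integral_indicator[symmetric]) simp
  also have "\<dots> = (\<integral>\<^sup>+w. indicator {..enat x} (peak (start g w)) \<partial>IN)"
    by (rule nn_integral_distr) measurable
  also have "\<dots> = (\<integral>\<^sup>+w. (if peak (start g w) \<le> enat x then 1 else 0) \<partial>IN)"
    by (rule nn_integral_cong) (simp add: indicator_def)
  also have "\<dots> = (\<integral>\<^sup>+y. \<integral>\<^sup>+w. (if peak (fst (g (snd y)), snd (g (snd y)), fst y, w) \<le> enat x then 1 else 0) \<partial>IN \<partial>X)"
    by (subst nn_integral_IN_split) (simp_all add: start_def)
  also have "\<dots> = (\<integral>\<^sup>+b. \<integral>\<^sup>+d. \<integral>\<^sup>+t. \<integral>\<^sup>+w.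
      (if peak (fst (g (b, d)), snd (g (b, d)), t, w) \<le> enat x then 1 else 0) \<partial>IN \<partial>E \<partial>DS \<partial>measure_pmf \<beta>)"
    by (subst nn_integral_X_split) simp_all
  also have "\<dots> = (\<integral>\<^sup>+b. \<integral>\<^sup>+d. peak_cdf x (g (b, d)) \<partial>DS \<partial>measure_pmf \<beta>)"
  proof (rule nn_integral_cong, rule nn_integral_cong_AE)
    fix b
    show "AE d in DS. (\<integral>\<^sup>+t. \<integral>\<^sup>+w. (if peak (fst (g (b, d)), snd (g (b, d)), t, w) \<le> enat x then 1 else 0) \<partial>IN \<partial>E)
        = peak_cdf x (g (b, d))"
      using AE_DS_nonneg
    proof eventually_elim
      case (elim d)
      show ?case using prob_peak_le[OF nonneg[OF elim, of b], of "fst (g (b, d))" x] by simp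
    qed
  qed
  finally show ?thesis .
qed

lemma lawM_eq: "lawM lam \<beta> Sd = distr IN (count_space UNIV) (\<lambda>w. peak (start (\<lambda>y. y) w))"
  by (simp add: lawM_def inputM_eq maxQ_eq_peak[abs_def] start_def)

lemma lawMks_eq:
  "lawMks lam \<beta> Sd k s = distr IN (count_space UNIV) (\<lambda>w. peak (start (\<lambda>(b, d). (k, case_nat s (\<lambda>i. d (Suc i)))) w))"
proof -
  have "d(0 := s) = case_nat s (\<lambda>i. d (Suc i))" for d :: "nat \<Rightarrow> real"
    by (auto simp: fun_eq_iff split: nat.split)
  then show ?thesis
    by (simp add: lawMks_def inputM_eq maxQ_eq_peak start_def setX0_def setS0_def case_prod_beta)
qed

text \<open>An empty initial stack has peak 0, so the convention for \<open>k = 0\<close> fits the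
  general form.\<close>

lemma lawMk_eq:
  "lawMk lam \<beta> Sd k = distr IN (count_space UNIV) (\<lambda>w. peak (start (\<lambda>(b, d). (k, d)) w))"
proof (cases k)
  case 0
  have "distr IN (count_space UNIV) (\<lambda>w. 0) = return (count_space UNIV) (0 :: enat)"
    by (intro measure_eqI) (auto simp: emeasure_distr indicator_def)
  with 0 show ?thesis by (simp add: lawMk_def start_def case_prod_beta)
next
  case (Suc _)
  then show ?thesis
    by (simp add: lawMk_def inputM_eq maxQ_eq_peak start_def setX0_def case_prod_beta)
qed

lemma emeasure_lawM: "emeasure (lawM lam \<beta> Sd) {..enat x} = (\<integral>\<^sup>+b. \<integral>\<^sup>+d. peak_cdf x (b, d) \<partial>DS \<partial>measure_pmf \<beta>)"
  unfolding lawM_eq by (rule law_peak_le) auto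

lemma emeasure_lawMk: "emeasure (lawMk lam \<beta> Sd k) {..enat x} = (\<integral>\<^sup>+d. peak_cdf x (k, d) \<partial>DS)"
  unfolding lawMk_eq by (subst law_peak_le) auto

lemma emeasure_lawMks:
  assumes "0 \<le> s"
  shows "emeasure (lawMks lam \<beta> Sd k s) {..enat x} = (\<integral>\<^sup>+d. peak_cdf x (k, case_nat s d) \<partial>DS)"
proof -
  have "emeasure (lawMks lam \<beta> Sd k s) {..enat x} =
      (\<integral>\<^sup>+b. \<integral>\<^sup>+d. peak_cdf x (k, case_nat s (\<lambda>i. d (Suc i))) \<partial>DS \<partial>measure_pmf \<beta>)"
    unfolding lawMks_eq using assms by (subst law_peak_le) (auto split: nat.split)
  also have "\<dots> = (\<integral>\<^sup>+d. peak_cdf x (k, case_nat s (\<lambda>i. d (Suc i))) \<partial>DS)"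
    by simp
  \<comment> \<open>The requirements below the top form an i.i.d. sequence again and may be renamed
    \<open>d\<close>.\<close>
  also have "\<dots> = (\<integral>\<^sup>+d. peak_cdf x (k, case_nat s d) \<partial>DS)"
    by (subst nn_integral_DS_split) simp_all
  finally show ?thesis .
qed

lemma emeasure_lawI:
  "emeasure (lawI lam \<beta> Sd s) {True} = arrival_prob s" "emeasure (lawI lam \<beta> Sd s) {False} = service_prob s"
proof -
  have *: "emeasure (lawI lam \<beta> Sd s) {v} = (\<integral>\<^sup>+t. (if (t < s) = v then 1 else 0) \<partial>E)" for v
  proof -
    have "emeasure (lawI lam \<beta> Sd s) {v} = (\<integral>\<^sup>+y. indicator {v} y \<partial>lawI lam \<beta> Sd s)"
      by (rule nn_integral_indicator[symmetric]) (simp add: lawI_def)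
    also have "\<dots> = (\<integral>\<^sup>+w. indicator {v} (fst (w 0) < s) \<partial>IN)"
      unfolding lawI_def inputM_eq by (rule nn_integral_distr) measurable
    also have "\<dots> = (\<integral>\<^sup>+w. (if (fst (w 0) < s) = v then 1 else 0) \<partial>IN)"
      by (rule nn_integral_cong) (auto simp: indicator_def)
    also have "\<dots> = (\<integral>\<^sup>+y. (if (fst y < s) = v then 1 else 0) \<partial>X)"
      by (subst nn_integral_IN_split) simp_all
    also have "\<dots> = (\<integral>\<^sup>+t. (if (t < s) = v then 1 else 0) \<partial>E)"
      by (subst nn_integral_X_split) simp_all
    finally show ?thesis .
  qed
  show "emeasure (lawI lam \<beta> Sd s) {True} = arrival_prob s" unfolding * arrival_prob_def by simp
  show "emeasure (lawI lam \<beta> Sd s) {False} = service_prob s" unfolding * service_prob_def by (intro nn_integral_cong) simp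
qed

lemma prob_space_laws:
  "prob_space (lawI lam \<beta> Sd s)" "prob_space (lawM lam \<beta> Sd)"
  "prob_space (lawMk lam \<beta> Sd k)" "prob_space (lawMks lam \<beta> Sd k s)"
  unfolding lawI_def lawM_eq lawMk_eq lawMks_eq inputM_eq
  by (intro W.prob_space_distr; measurable)+

lemma sets_laws:
  "sets (lawI lam \<beta> Sd s) = UNIV" "sets (lawM lam \<beta> Sd) = UNIV"
  "sets (lawMk lam \<beta> Sd k) = UNIV" "sets (lawMks lam \<beta> Sd k s) = UNIV"
  unfolding lawI_def lawM_eq lawMk_eq lawMks_eq by simp_all

text \<open>An arriving batch sits on the \<open>k\<close> waiting customers like a busy period of
  its own with bound \<open>x - k\<close>; afterwards the same stack restarts with the same
  \<open>s\<close>. A completion leaves \<open>k - 1\<close> customers with fresh i.i.d.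
  requirements.\<close>

lemma lawMks_cdf_rec:
  assumes "0 < k" "k \<le> x" "0 \<le> s"
  shows "emeasure (lawMks lam \<beta> Sd k s) {..enat x} =
    arrival_prob s * (emeasure (lawM lam \<beta> Sd) {..enat (x - k)} * emeasure (lawMks lam \<beta> Sd k s) {..enat x})
    + service_prob s * emeasure (lawMk lam \<beta> Sd (k - 1)) {..enat x}"
proof -
  let ?m = "emeasure (lawM lam \<beta> Sd) {..enat (x - k)}"
  \<comment> \<open>Proved for each fixed \<open>d\<close>: the coefficients depend only on
    \<open>s\<close>, \<open>k\<close> and \<open>x\<close>, so the identity is linear in the
    \<open>d\<close>-dependent factors and survives integration.\<close>
  have rec: "peak_cdf x (k, case_nat s d) = arrival_prob s * (?m * peak_cdf x (k, case_nat s d)) + service_prob s * peak_cdf x (k - 1, d)" for d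
  proof -
    have "peak_cdf x (k + b, comb_seq b d' (case_nat s d)) = peak_cdf (x - k) (b, d') * peak_cdf x (k, case_nat s d)" for b d'
      using peak_cdf_append[of "x - k" k b d' "case_nat s d"] assms(2) by (simp add: add.commute)
    then have "(\<integral>\<^sup>+b. \<integral>\<^sup>+d'. peak_cdf x (k + b, comb_seq b d' (case_nat s d)) \<partial>DS \<partial>measure_pmf \<beta>) =
        ?m * peak_cdf x (k, case_nat s d)"
      by (simp add: nn_integral_multc emeasure_lawM)
    then show ?thesis
      by (subst peak_cdf_rec[OF assms(1,2)]) simp
  qed
  have "emeasure (lawMks lam \<beta> Sd k s) {..enat x} =
      (\<integral>\<^sup>+d. arrival_prob s * (?m * peak_cdf x (k, case_nat s d)) + service_prob s * peak_cdf x (k - 1, d) \<partial>DS)"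
    unfolding emeasure_lawMks[OF assms(3)] by (rule nn_integral_cong[OF rec])
  also have "\<dots> = arrival_prob s * (?m * (\<integral>\<^sup>+d. peak_cdf x (k, case_nat s d) \<partial>DS)) + service_prob s * (\<integral>\<^sup>+d. peak_cdf x (k - 1, d) \<partial>DS)"
    by (simp add: nn_integral_add nn_integral_cmult)
  finally show ?thesis unfolding emeasure_lawMks[OF assms(3)] emeasure_lawMk .
qed

text \<open>Comparison of distribution functions: independence turns the maximum of
  \<open>m + k\<close> and \<open>m'\<close> into the product in
  \<open>lawMks_cdf_rec\<close>.\<close>

lemma lawMks_eq_mixture:
  assumes "1 \<le> k" and "0 \<le> s"
  shows "lawMks lam \<beta> Sd k s =
    distr (lawI lam \<beta> Sd s \<Otimes>\<^sub>M (lawM lam \<beta> Sd \<Otimes>\<^sub>M (lawMks lam \<beta> Sd k s \<Otimes>\<^sub>M lawMk lam \<beta> Sd (k - 1))))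
      (count_space UNIV)
      (\<lambda>(i, m, m', m''). if i then max (m + enat k) m' else max (enat k) m'')"
proof -
  note sets = sets_laws(1,2) sets_laws(4,3)
  note probs = prob_space_laws(1,2) prob_space_laws(4,3)
  let ?P = "lawI lam \<beta> Sd s \<Otimes>\<^sub>M (lawM lam \<beta> Sd \<Otimes>\<^sub>M (lawMks lam \<beta> Sd k s \<Otimes>\<^sub>M lawMk lam \<beta> Sd (k - 1)))"
  show ?thesis
  proof (rule prob_enat_eqI)
    show "prob_space (lawMks lam \<beta> Sd k s)" by (rule probs)
    have "prob_space ?P"
      by (intro prob_space_pair probs)
    then show "prob_space (distr ?P (count_space UNIV)
        (\<lambda>(i, m, m', m''). if i then max (m + enat k) m' else max (enat k) m''))"
      by (rule prob_space.prob_space_distr) (rule measurable_pair4_count[OF sets])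
    fix x
    show "emeasure (lawMks lam \<beta> Sd k s) {..enat x} = emeasure (distr ?P (count_space UNIV)
        (\<lambda>(i, m, m', m''). if i then max (m + enat k) m' else max (enat k) m'')) {..enat x}"
    proof (cases "k \<le> x")
      case True
      show ?thesis
        unfolding emeasure_mixture_le[OF probs sets] emeasure_lawI if_P[OF True]
        by (rule lawMks_cdf_rec) (use True assms in auto)
    next
      \<comment> \<open>The initial height \<open>k\<close> already exceeds \<open>x\<close>, so
        both sides are 0.\<close>
      case False
      then show ?thesis
        using assms(2) by (simp add: emeasure_mixture_le[OF probs sets] emeasure_lawMks peak_cdf_exceed)
    qed
  qed (simp_all add: sets)
qed

end

theorem theorem5:
  fixes lam :: real and \<beta> :: "nat pmf" and Sd :: "real measure" and k :: nat and s :: real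
  assumes "0 < lam"
    and "prob_space Sd" and "sets Sd = sets borel" and "AE x in Sd. 0 \<le> x"
    and "set_pmf \<beta> \<subseteq> {1..}" and "integrable (measure_pmf \<beta>) real"
    and "(\<integral>\<^sup>+ x. ennreal (exp (lam * x)) \<partial>Sd)
           < ennreal ((measure_pmf.expectation \<beta> real + 1) / measure_pmf.expectation \<beta> real)"
    and "1 \<le> k" and "0 \<le> s"
  shows "lawMks lam \<beta> Sd k s =
    distr (lawI lam \<beta> Sd s \<Otimes>\<^sub>M (lawM lam \<beta> Sd \<Otimes>\<^sub>M (lawMks lam \<beta> Sd k s \<Otimes>\<^sub>M lawMk lam \<beta> Sd (k - 1))))
      (count_space UNIV)
      (\<lambda>(i, m, m', m''). if i then max (m + enat k) m' else max (enat k) m'')"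
  by (rule mxg1.lawMks_eq_mixture[OF mxg1.intro[OF assms(1-5)] assms(8,9)])

end
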